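(* Let $G$ be a graph with $\operatorname{rad}(G)=1$ and $\operatorname{diam}(G)=2$, and let $u$ be a universal vertex of $G$. Then $G$ is $\chi_\rho$-critical if and only if either (i) $G-u$ is connected, $\operatorname{rad}(G-u)\ge 3$, and $G-u$ is $\alpha$-critical, or (ii) $G-u$ is disconnected and each component of $G-u$ is $\alpha$-critical.
   Context: All graphs are finite and simple. $d_G(x,y)$ is the length of a shortest $x$--$y$ path in $G$; the eccentricity of a vertex is its maximum distance to any other vertex, and $\operatorname{rad}(G)$ and $\operatorname{diam}(G)$ are the minimum and maximum eccentricity of the vertices of $G$. A vertex $u$ is universal if it is adjacent to every other vertex, and $G-u$ is the graph obtained from $G$ by removing $u$. For a positive integer $i$, an $i$-packing in $G$ is a set $X\subseteq V(G)$ such that $d_G(x,y)>i$ for all distinct $x,y\in X$ (vertices in different components are at infinite distance). The packing chromatic number $\chi_\rho(G)$ is the smallest positive integer $k$ for which there exists a partition $X_1,\dots,X_k$ of $V(G)$ such that $X_i$ is an $i$-packing in $G$ for every $i\in\{1,\dots,k\}$. A graph $G$ is $\chi_\rho$-critical if $\chi_\rho(H)<\chi_\rho(G)$ for every proper subgraph $H$ of $G$. The independence number $\alpha(G)$ is the maximum size of an independent set in $G$. A graph $G$ is $\alpha$-critical if $\alpha(G-e)>\alpha(G)$ for every edge $e\in E(G)$, where $G-e$ is obtained from $G$ by removing the edge $e$.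
   Formalization: In (ii) each component of G−u is also required to contain an edge: a single vertex is vacuously α-critical, so the literal statement fails for the path P_3, where G−u is two isolated vertices but χ_ρ(P_3) = χ_ρ(P_2) = 2, so P_3 is not χ_ρ-critical. *)

theory Defs
  imports
    "Graph_Theory.Digraph_Component"
    "HOL-Library.Extended_Nat"
    "HOL-Library.Disjoint_Sets"
begin

text \<open>
  Finite simple graphs are the members of the locale \<^locale>\<open>graph\<close>, i.e. finite symmetric
  digraphs without loops and parallel arcs.  An edge \<open>xy\<close> is thus the pair of arcs from \<open>x\<close> to \<open>y\<close>
  and from \<open>y\<close> to \<open>x\<close>.
\<close>

text \<open>The infimum of the empty set is \<open>\<infinity>\<close>, the distance between vertices in different components.\<close>

definition vdist :: "('a, 'b) pre_digraph \<Rightarrow> 'a \<Rightarrow> 'a \<Rightarrow> enat" where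
  "vdist G x y = (INF p \<in> {p. pre_digraph.apath G x p y}. enat (length p))"

definition ecc :: "('a, 'b) pre_digraph \<Rightarrow> 'a \<Rightarrow> enat" where
  "ecc G x = (SUP y \<in> verts G - {x}. vdist G x y)"

definition radius :: "('a, 'b) pre_digraph \<Rightarrow> enat" where
  "radius G = (INF x \<in> verts G. ecc G x)"

definition diam :: "('a, 'b) pre_digraph \<Rightarrow> enat" where
  "diam G = (SUP x \<in> verts G. ecc G x)"

definition universal :: "('a, 'b) pre_digraph \<Rightarrow> 'a \<Rightarrow> bool" where
  "universal G u \<longleftrightarrow> u \<in> verts G \<and> (\<forall>v \<in> verts G. v \<noteq> u \<longrightarrow> u \<rightarrow>\<^bsub>G\<^esub> v)"

definition packing :: "('a, 'b) pre_digraph \<Rightarrow> nat \<Rightarrow> 'a set \<Rightarrow> bool" where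
  "packing G i X \<longleftrightarrow> X \<subseteq> verts G \<and> (\<forall>x \<in> X. \<forall>y \<in> X. x \<noteq> y \<longrightarrow> vdist G x y > enat i)"

text \<open>
  Parts may be empty.  This does not affect the minimum on nonempty graphs, since an empty part
  \<open>X\<^sub>i\<close> with \<open>i < k\<close> can be replaced by the last part \<open>X\<^sub>k\<close>; it gives the null graph the value 1.
\<close>

definition packing_partition :: "('a, 'b) pre_digraph \<Rightarrow> nat \<Rightarrow> (nat \<Rightarrow> 'a set) \<Rightarrow> bool" where
  "packing_partition G k X \<longleftrightarrow>
     (\<Union>i \<in> {1..k}. X i) = verts G \<and> disjoint_family_on X {1..k} \<and> (\<forall>i \<in> {1..k}. packing G i (X i))"

definition packing_chromatic :: "('a, 'b) pre_digraph \<Rightarrow> nat" where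
  "packing_chromatic G = (LEAST k. k \<ge> 1 \<and> (\<exists>X. packing_partition G k X))"

text \<open>
  \<^const>\<open>subgraph\<close> alone would also admit subdigraphs containing only one of the two arcs of an edge.
\<close>

definition packing_critical :: "('a, 'b) pre_digraph \<Rightarrow> bool" where
  "packing_critical G \<longleftrightarrow>
     (\<forall>H. graph H \<and> subgraph H G \<and> H \<noteq> G \<longrightarrow> packing_chromatic H < packing_chromatic G)"

definition independent_set :: "('a, 'b) pre_digraph \<Rightarrow> 'a set \<Rightarrow> bool" where
  "independent_set G S \<longleftrightarrow> S \<subseteq> verts G \<and> (\<forall>x \<in> S. \<forall>y \<in> S. \<not> x \<rightarrow>\<^bsub>G\<^esub> y)"

definition independence_number :: "('a, 'b) pre_digraph \<Rightarrow> nat" where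
  "independence_number G = Max (card ` {S. independent_set G S})"

text \<open>Removing an edge, given by one of its arcs \<open>e\<close>, removes both arcs joining its ends.\<close>

definition del_edge :: "('a, 'b) pre_digraph \<Rightarrow> 'b \<Rightarrow> ('a, 'b) pre_digraph" where
  "del_edge G e = G\<lparr>arcs := {a \<in> arcs G. {tail G a, head G a} \<noteq> {tail G e, head G e}}\<rparr>"

definition alpha_critical :: "('a, 'b) pre_digraph \<Rightarrow> bool" where
  "alpha_critical G \<longleftrightarrow>
     (\<forall>e \<in> arcs G. independence_number (del_edge G e) > independence_number G)"

text \<open>
  In a symmetric digraph, reachability is symmetric, so the strongly connected components are
  the connected components.
\<close>

abbreviation components :: "('a, 'b) pre_digraph \<Rightarrow> ('a, 'b) pre_digraph set" where
  "components G \<equiv> pre_digraph.sccs G"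

end

theory Submission
  imports Defs
begin

text \<open>
  Write \<open>F = G - u\<close> and let \<open>n\<close> be the number of vertices of \<open>G\<close>.  In a graph of diameter at
  most 2 a colour \<open>i \<ge> 2\<close> is used on at most one vertex, while colour 1 may be used on any
  independent set.  With a universal vertex this gives \<open>\<chi>\<^sub>\<rho>(G) = n - \<alpha>(F) + 1\<close>
  (\<open>packing_chromatic_universal\<close>).

  A graph without isolated vertices is critical as soon as the deletion of each single edge lowers
  \<open>\<chi>\<^sub>\<rho>\<close>.  If \<open>e\<close> lies in \<open>F\<close>, then \<open>u\<close> stays universal in \<open>G - e\<close>, so the formula above shows that
  \<open>\<chi>\<^sub>\<rho>\<close> drops exactly when \<open>\<alpha>(F - e) > \<alpha>(F)\<close>.  Hence the edges of \<open>F\<close> contribute precisely the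
  condition that \<open>F\<close> is \<open>\<alpha>\<close>-critical.

  Now delete an edge \<open>ux\<close>.  Only pairs involving \<open>x\<close> can reach distance 3.  If \<open>x\<close> is isolated in
  \<open>F\<close>, or if all of \<open>F\<close> is within distance 2 of \<open>x\<close>, then counting as before shows that
  \<open>\<chi>\<^sub>\<rho>\<close> does not drop.  Conversely, suppose that \<open>F\<close> is \<open>\<alpha>\<close>-critical without isolated vertices and
  that some vertex is farther than 2 from \<open>x\<close> in \<open>F\<close>.  Then there are such a vertex \<open>y\<close> and a
  maximum independent set \<open>S\<close> of \<open>F\<close> avoiding both \<open>x\<close> and \<open>y\<close>
  (\<open>maximum_independent_set_avoiding_far_pair\<close>); giving colour 1 to \<open>S\<close>, colour 2 to \<open>x\<close> and \<open>y\<close>, and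
  a colour of its own to each other vertex uses \<open>n - \<alpha>(F)\<close> colours.

  So \<open>G\<close> is critical iff \<open>F\<close> is \<open>\<alpha>\<close>-critical, has no isolated vertex, and every vertex of \<open>F\<close> has
  another one farther than 2 away (\<open>packing_critical_universal_iff\<close>).  If \<open>F\<close> is connected, there are
  no isolated vertices and the last condition says that the radius is at least 3.  If \<open>F\<close> is
  disconnected, the last condition holds automatically, and the first two can be checked on the
  components, \<open>\<alpha>\<close>-criticality because the independence number is additive over them.
\<close>

section \<open>Short distances\<close>

lemma enat_less_vdist_iff:
  "enat n < vdist G x y \<longleftrightarrow> (\<forall>p. pre_digraph.apath G x p y \<longrightarrow> n < length p)"
proof -
  have "enat n < vdist G x y \<longleftrightarrow> enat (Suc n) \<le> vdist G x y"
    by (simp add: Suc_ile_eq)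
  also have "\<dots> \<longleftrightarrow> (\<forall>p. pre_digraph.apath G x p y \<longrightarrow> n < length p)"
    unfolding vdist_def by (auto simp: le_INF_iff Suc_le_eq)
  finally show ?thesis .
qed

lemma vdist_subgraph_mono:
  assumes "subgraph H G"
  shows "vdist G x y \<le> vdist H x y"
proof -
  interpret wf_digraph G using assms by auto
  show ?thesis
    unfolding vdist_def using assms
    by (intro INF_superset_mono) (auto intro: subgraph_apath_imp_apath)
qed

lemma (in graph) adj_sym: "x \<rightarrow> y \<longleftrightarrow> y \<rightarrow> x"
  using graph_symmetric by blast

lemma (in graph) one_less_vdist_iff:
  assumes "x \<in> verts G" "y \<in> verts G" "x \<noteq> y"
  shows "enat 1 < vdist G x y \<longleftrightarrow> \<not> x \<rightarrow> y"
proof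
  assume far: "enat 1 < vdist G x y"
  show "\<not> x \<rightarrow> y"
  proof
    assume "x \<rightarrow> y"
    then obtain e where "e \<in> arcs G" "tail G e = x" "head G e = y" by auto
    then have "apath x [e] y"
      using assms by (simp add: apath_simps)
    with far show False by (auto simp: enat_less_vdist_iff)
  qed
next
  assume *: "\<not> x \<rightarrow> y"
  have "1 < length p" if "apath x p y" for p
  proof (cases p)
    case Nil
    then show ?thesis using that assms by (simp add: apath_simps)
  next
    case (Cons e q)
    then have "q \<noteq> []"
      using that * by (auto simp: apath_simps arcs_ends_conv)
    then show ?thesis using Cons by simp
  qed
  then show "enat 1 < vdist G x y" by (simp add: enat_less_vdist_iff)
qed

lemma (in graph) two_less_vdist_iff:
  assumes "x \<in> verts G" "y \<in> verts G"
  shows "enat 2 < vdist G x y \<longleftrightarrow> x \<noteq> y \<and> \<not> x \<rightarrow> y \<and> \<not> (\<exists>z. x \<rightarrow> z \<and> z \<rightarrow> y)"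
proof
  assume far: "enat 2 < vdist G x y"
  have "x \<noteq> y"
  proof
    assume "x = y"
    then have "apath x [] y" using assms by (simp add: apath_simps)
    with far show False by (auto simp: enat_less_vdist_iff)
  qed
  have nadj: "\<not> x \<rightarrow> y"
  proof -
    have "enat 1 < enat 2" by simp
    also note far
    finally show ?thesis using one_less_vdist_iff[OF assms \<open>x \<noteq> y\<close>] by blast
  qed
  have "\<not> (\<exists>z. x \<rightarrow> z \<and> z \<rightarrow> y)"
  proof
    assume "\<exists>z. x \<rightarrow> z \<and> z \<rightarrow> y"
    then obtain z where z: "x \<rightarrow> z" "z \<rightarrow> y" by blast
    obtain e where "e \<in> arcs G" "tail G e = x" "head G e = z" using z(1) by auto
    moreover obtain f where "f \<in> arcs G" "tail G f = z" "head G f = y" using z(2) by auto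
    moreover have "x \<noteq> z" "z \<noteq> y" using z adj_not_same by auto
    ultimately have "apath x [e, f] y"
      using assms \<open>x \<noteq> y\<close> by (auto simp: apath_simps)
    with far show False by (auto simp: enat_less_vdist_iff)
  qed
  with \<open>x \<noteq> y\<close> nadj show "x \<noteq> y \<and> \<not> x \<rightarrow> y \<and> \<not> (\<exists>z. x \<rightarrow> z \<and> z \<rightarrow> y)" by blast
next
  assume *: "x \<noteq> y \<and> \<not> x \<rightarrow> y \<and> \<not> (\<exists>z. x \<rightarrow> z \<and> z \<rightarrow> y)"
  have "2 < length p" if p: "apath x p y" for p
  proof (cases p)
    case Nil
    then show ?thesis using p * by (simp add: apath_simps)
  next
    case (Cons e q)
    then have "q \<noteq> []" "x \<rightarrow> head G e"
      using p * by (auto simp: apath_simps arcs_ends_conv)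
    then obtain f r where q: "q = f # r" by (cases q) auto
    have "f \<in> arcs G" "tail G f = head G e"
      using p Cons q by (auto simp: apath_simps)
    then have "head G e \<rightarrow> head G f"
      by (intro dominatesI[of f]) (auto simp: arc_to_ends_def)
    then have "r \<noteq> []"
      using p Cons q * \<open>x \<rightarrow> head G e\<close> by (auto simp: apath_simps)
    then show ?thesis using Cons q by (cases r) auto
  qed
  then show "enat 2 < vdist G x y" by (simp add: enat_less_vdist_iff)
qed

lemma (in graph) packing_one_iff: "packing G 1 X \<longleftrightarrow> independent_set G X"
proof -
  have "(x \<noteq> y \<longrightarrow> enat 1 < vdist G x y) \<longleftrightarrow> \<not> x \<rightarrow> y"
    if "x \<in> verts G" "y \<in> verts G" for x y
    using one_less_vdist_iff[OF that] adj_not_same by blast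
  then show ?thesis
    unfolding packing_def independent_set_def by blast
qed

section \<open>Bounds for the packing chromatic number\<close>

lemma packing_chromatic_le:
  assumes "packing_partition G k X" "1 \<le> k"
  shows "packing_chromatic G \<le> k"
  unfolding packing_chromatic_def by (rule Least_le) (use assms in blast)

lemma packing_singleton: "x \<in> verts G \<Longrightarrow> packing G i {x}"
  by (simp add: packing_def)

text \<open>
  The vertices outside \<open>I\<close> and \<open>P\<close> get colours of their own, from 3 on.
\<close>

lemma packing_partition_from_two_classes:
  assumes fin: "finite (verts G)" and I: "packing G 1 I" and P: "packing G 2 P" and "I \<inter> P = {}"
  obtains X where "packing_partition G (card (verts G - I - P) + 2) X"
proof -
  define R where "R = verts G - I - P"
  have "finite R" using fin by (simp add: R_def)
  then obtain h where h: "bij_betw h {0..<card R} R"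
    using ex_bij_betw_nat_finite by blast
  define X where "X i = (if i = 1 then I else if i = 2 then P else {h (i - 3)})" for i :: nat
  have hR: "h (i - 3) \<in> R" if "3 \<le> i" "i \<le> card R + 2" for i
    using h that by (auto simp: bij_betw_def)
  have sub: "I \<subseteq> verts G" "P \<subseteq> verts G" using I P by (auto simp: packing_def)
  have "packing_partition G (card R + 2) X"
    unfolding packing_partition_def
  proof (intro conjI ballI)
    show "(\<Union>i\<in>{1..card R + 2}. X i) = verts G"
    proof
      show "(\<Union>i\<in>{1..card R + 2}. X i) \<subseteq> verts G"
        using sub hR by (auto simp: X_def R_def split: if_splits)
      show "verts G \<subseteq> (\<Union>i\<in>{1..card R + 2}. X i)"
      proof
        fix v assume "v \<in> verts G"
        then consider "v \<in> I" | "v \<in> P" | "v \<in> R" by (auto simp: R_def)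
        then show "v \<in> (\<Union>i\<in>{1..card R + 2}. X i)"
        proof cases
          case 1
          then show ?thesis by (intro UN_I[of 1]) (auto simp: X_def)
        next
          case 2
          then show ?thesis by (intro UN_I[of 2]) (auto simp: X_def)
        next
          case 3
          then obtain j where "j < card R" "v = h j" using h by (fastforce simp: bij_betw_def)
          then show ?thesis by (intro UN_I[of "j + 3"]) (auto simp: X_def)
        qed
      qed
    qed
    have disj: "X i \<inter> X j = {}" if "1 \<le> i" "i < j" "j \<le> card R + 2" for i j
    proof (cases "i \<le> 2")
      case True
      then have "i = 1 \<or> i = 2" using that by auto
      then show ?thesis
        using that hR[of j] \<open>I \<inter> P = {}\<close> by (cases "j = 2") (auto simp: X_def R_def)
    next
      case False
      then have "i - 3 \<noteq> j - 3" "i - 3 \<in> {0..<card R}" "j - 3 \<in> {0..<card R}"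
        using that by auto
      then have "h (i - 3) \<noteq> h (j - 3)"
        using inj_on_contraD[OF bij_betw_imp_inj_on[OF h]] by blast
      then show ?thesis using False that by (auto simp: X_def)
    qed
    show "disjoint_family_on X {1..card R + 2}"
      unfolding disjoint_family_on_def
    proof (intro ballI impI)
      fix i j assume "i \<in> {1..card R + 2}" "j \<in> {1..card R + 2}" "i \<noteq> j"
      then show "X i \<inter> X j = {}"
        using disj[of i j] disj[of j i] by (cases "i < j") auto
    qed
  next
    fix i assume i: "i \<in> {1..card R + 2}"
    show "packing G i (X i)"
    proof (cases "i \<le> 2")
      case True
      then have "i = 1 \<or> i = 2" using i by auto
      then show ?thesis using I P by (auto simp: X_def)
    next
      case False
      then show ?thesis
        using i hR[of i] by (auto simp: X_def R_def intro!: packing_singleton)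
    qed
  qed
  then show ?thesis using that by (simp add: R_def)
qed

lemma packing_chromatic_two_classes:
  assumes fin: "finite (verts G)" and I: "packing G 1 I" and P: "packing G 2 P" and disj: "I \<inter> P = {}"
  shows "packing_chromatic G + card I + card P \<le> card (verts G) + 2"
proof -
  obtain X where "packing_partition G (card (verts G - I - P) + 2) X"
    using packing_partition_from_two_classes[OF assms] .
  then have "packing_chromatic G \<le> card (verts G - I - P) + 2"
    by (rule packing_chromatic_le) simp
  moreover have "card (verts G - I - P) + card I + card P = card (verts G)"
  proof -
    have sub: "I \<union> P \<subseteq> verts G" using I P by (auto simp: packing_def)
    then have "finite I" "finite P" using fin by (auto intro: finite_subset)
    then have "card (I \<union> P) = card I + card P" using disj by (rule card_Un_disjoint)
    moreover have "card (verts G - (I \<union> P)) = card (verts G) - card (I \<union> P)"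
      using sub fin by (meson card_Diff_subset finite_subset)
    moreover have "card (I \<union> P) \<le> card (verts G)" using sub fin by (rule card_mono[rotated])
    ultimately show ?thesis by (simp add: Diff_eq Int_assoc)
  qed
  ultimately show ?thesis by simp
qed

lemma packing_chromatic_partition:
  assumes "finite (verts G)"
  obtains X where "1 \<le> packing_chromatic G" "packing_partition G (packing_chromatic G) X"
proof -
  have "packing G i {}" for i by (simp add: packing_def)
  then obtain X where "packing_partition G (card (verts G - {} - {}) + 2) X"
    using packing_partition_from_two_classes[of G "{}" "{}"] assms by blast
  then have "\<exists>k\<ge>1. \<exists>X. packing_partition G k X"
    by (intro exI[of _ "card (verts G - {} - {}) + 2"]) auto
  then have "1 \<le> packing_chromatic G \<and> (\<exists>X. packing_partition G (packing_chromatic G) X)"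
    unfolding packing_chromatic_def by (rule LeastI_ex)
  then show ?thesis using that by blast
qed

lemma packing_chromatic_mono:
  assumes "subgraph H G" "finite (verts G)"
  shows "packing_chromatic H \<le> packing_chromatic G"
proof -
  obtain X where k: "1 \<le> packing_chromatic G"
    and X: "packing_partition G (packing_chromatic G) X"
    using packing_chromatic_partition[OF assms(2)] .
  have "packing H i (Y \<inter> verts H)" if "packing G i Y" for i Y
    using that vdist_subgraph_mono[OF assms(1)]
    unfolding packing_def by (blast intro: order_less_le_trans)
  then have "packing_partition H (packing_chromatic G) (\<lambda>i. X i \<inter> verts H)"
    using X assms(1) unfolding packing_partition_def
    by (auto simp: subgraph_def intro: disjoint_family_on_bisimulation)
  then show ?thesis using k by (rule packing_chromatic_le)
qed

text \<open>
  Outside \<open>A\<close> each colour from 2 on is used at most once.  The set \<open>A\<close> of excluded vertices leaves room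
  for a vertex that is far away from the others.
\<close>

lemma card_le_packing_partition:
  assumes fin: "finite (verts G)" and X: "packing_partition G k X" and k: "1 \<le> k"
    and close: "\<And>y z. y \<in> verts G - A \<Longrightarrow> z \<in> verts G - A \<Longrightarrow> y \<noteq> z \<Longrightarrow> vdist G y z \<le> enat 2"
  shows "card (verts G - A) + 1 \<le> card (X 1 - A) + k"
proof -
  have sub: "X i \<subseteq> verts G" if "i \<in> {1..k}" for i
    using X that by (auto simp: packing_partition_def)
  have le1: "card (X i - A) \<le> 1" if i: "i \<in> {2..k}" for i
  proof -
    have pack: "packing G i (X i)" using X i by (auto simp: packing_partition_def)
    have "y = z" if yz: "y \<in> X i - A" "z \<in> X i - A" for y z
    proof (rule ccontr)
      assume "y \<noteq> z"
      then have "enat i < vdist G y z" using pack yz by (auto simp: packing_def)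
      also have "vdist G y z \<le> enat 2" using yz sub[of i] i \<open>y \<noteq> z\<close> by (intro close) auto
      finally show False using i by simp
    qed
    then show ?thesis
      using fin sub[of i] i by (auto intro!: card_le_Suc0_iff_eq[THEN iffD2] intro: finite_subset)
  qed
  have "verts G - A = (X 1 - A) \<union> (\<Union>i\<in>{2..k}. X i - A)"
  proof -
    have "{1..k} = insert 1 {2..k}" using k by auto
    moreover have "verts G = (\<Union>i\<in>{1..k}. X i)" using X by (simp add: packing_partition_def)
    ultimately show ?thesis by auto
  qed
  then have "card (verts G - A) \<le> card (X 1 - A) + card (\<Union>i\<in>{2..k}. X i - A)"
    by (simp add: card_Un_le)
  also have "card (\<Union>i\<in>{2..k}. X i - A) \<le> (\<Sum>i\<in>{2..k}. card (X i - A))"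
    by (rule card_UN_le) simp
  also have "\<dots> \<le> (\<Sum>i\<in>{2..k}. 1)" using le1 by (rule sum_mono)
  also have "\<dots> = k - 1" by simp
  finally show ?thesis using k by simp
qed

section \<open>Deleting vertices and edges\<close>

lemma arcs_ends_del_vert:
  "x \<rightarrow>\<^bsub>pre_digraph.del_vert G u\<^esub> y \<longleftrightarrow> x \<rightarrow>\<^bsub>G\<^esub> y \<and> x \<noteq> u \<and> y \<noteq> u"
  by (auto simp: arcs_ends_conv pre_digraph.del_vert_simps)

lemma del_edge_simps [simp]:
  "verts (del_edge G e) = verts G" "tail (del_edge G e) = tail G" "head (del_edge G e) = head G"
  "arcs (del_edge G e) = {a \<in> arcs G. {tail G a, head G a} \<noteq> {tail G e, head G e}}"
  by (simp_all add: del_edge_def)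

lemma arcs_ends_del_edge:
  "x \<rightarrow>\<^bsub>del_edge G e\<^esub> y \<longleftrightarrow> x \<rightarrow>\<^bsub>G\<^esub> y \<and> {x, y} \<noteq> {tail G e, head G e}"
  by (auto simp: arcs_ends_conv)

lemma (in graph) graph_subdigraph:
  assumes "subgraph H G" "symmetric H"
  shows "graph H"
  using digraph.graphI[OF digraph_subgraph[OF assms(1)] assms(2)] .

lemma (in graph) subgraph_del_edge: "subgraph (del_edge G e) G"
  by (intro subgraphI wf_digraph.intro) (auto simp: compatible_def)

lemma (in graph) graph_del_edge: "graph (del_edge G e)"
proof (rule graph_subdigraph[OF subgraph_del_edge])
  show "symmetric (del_edge G e)"
    using adj_sym by (auto simp: symmetric_def sym_def arcs_ends_del_edge insert_commute)
qed

lemma (in graph) graph_del_vert: "graph (del_vert u)"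
proof (rule graph_subdigraph[OF subgraph_del_vert])
  show "symmetric (del_vert u)"
    using adj_sym by (auto simp: symmetric_def sym_def arcs_ends_del_vert)
qed

lemma del_vert_del_edge:
  "pre_digraph.del_vert (del_edge G e) u = del_edge (pre_digraph.del_vert G u) e"
  by (intro pre_digraph.equality) (auto simp: pre_digraph.del_vert_simps)

text \<open>
  Without isolated vertices, every proper subgraph misses an edge, also when it misses a vertex; so
  it is a subgraph of some \<open>G - e\<close>, and the packing chromatic number is monotone.
\<close>

lemma (in graph) packing_critical_iff_edges:
  assumes noniso: "\<And>x. x \<in> verts G \<Longrightarrow> \<exists>y. x \<rightarrow> y"
  shows "packing_critical G \<longleftrightarrow>
    (\<forall>e \<in> arcs G. packing_chromatic (del_edge G e) < packing_chromatic G)"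
proof
  assume crit: "packing_critical G"
  show "\<forall>e \<in> arcs G. packing_chromatic (del_edge G e) < packing_chromatic G"
  proof
    fix e assume "e \<in> arcs G"
    then have "e \<in> arcs G - arcs (del_edge G e)" by simp
    then have "del_edge G e \<noteq> G" by force
    then show "packing_chromatic (del_edge G e) < packing_chromatic G"
      using crit graph_del_edge subgraph_del_edge unfolding packing_critical_def by blast
  qed
next
  assume edges: "\<forall>e \<in> arcs G. packing_chromatic (del_edge G e) < packing_chromatic G"
  show "packing_critical G"
    unfolding packing_critical_def
  proof (intro allI impI, elim conjE)
    fix H assume H: "graph H" "subgraph H G" "H \<noteq> G"
    interpret H: graph H by fact
    have ends: "tail H = tail G" "head H = head G"
      using H(2) by (auto simp: subgraph_def compatible_def)
    have sub: "verts H \<subseteq> verts G" "arcs H \<subseteq> arcs G" using H(2) by (auto simp: subgraph_def)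
    have "arcs H \<noteq> arcs G"
    proof
      assume eq: "arcs H = arcs G"
      have "verts G \<subseteq> verts H"
      proof
        fix x assume "x \<in> verts G"
        then obtain e where "e \<in> arcs H" "tail H e = x"
          using noniso ends eq by fastforce
        then show "x \<in> verts H" using H.tail_in_verts by blast
      qed
      then have "H = G" using eq ends sub by (intro pre_digraph.equality) auto
      with H(3) show False ..
    qed
    then obtain e where e: "e \<in> arcs G" "e \<notin> arcs H" using sub by blast
    have "{tail G a, head G a} \<noteq> {tail G e, head G e}" if a: "a \<in> arcs H" for a
    proof
      assume eq: "{tail G a, head G a} = {tail G e, head G e}"
      have "tail G a \<rightarrow>\<^bsub>H\<^esub> head G a" using a ends by (auto simp: arcs_ends_conv)
      \<comment> \<open>As \<open>H\<close> is symmetric, it cannot contain just the reverse of the missing arc.\<close>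
      then have "tail G e \<rightarrow>\<^bsub>H\<^esub> head G e"
        using eq H.adj_sym by (auto simp: doubleton_eq_iff)
      then obtain b where b: "b \<in> arcs H" "tail G b = tail G e" "head G b = head G e"
        using ends by (metis reachableE)
      then have "b = e" using e sub by (intro no_multi_arcs) (auto simp: arc_to_ends_def)
      with b e show False by simp
    qed
    then have "arcs H \<subseteq> arcs (del_edge G e)" using sub by auto
    then have "subgraph H (del_edge G e)"
      using sub ends graph_del_edge[of e] H.wf_digraph
      by (intro subgraphI) (auto simp: compatible_def graph_def digraph_def fin_digraph_def)
    then have "packing_chromatic H \<le> packing_chromatic (del_edge G e)"
      by (rule packing_chromatic_mono) simp
    also have "\<dots> < packing_chromatic G" using edges e by blast
    finally show "packing_chromatic H < packing_chromatic G" .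
  qed
qed

section \<open>Independent sets\<close>

lemma independent_set_finite: "finite (verts G) \<Longrightarrow> independent_set G S \<Longrightarrow> finite S"
  by (auto simp: independent_set_def intro: finite_subset)

lemma independent_set_subset: "independent_set G S \<Longrightarrow> T \<subseteq> S \<Longrightarrow> independent_set G T"
  unfolding independent_set_def by blast

lemma finite_independent_sets: "finite (verts G) \<Longrightarrow> finite {S. independent_set G S}"
  by (rule finite_subset[of _ "Pow (verts G)"]) (auto simp: independent_set_def)

lemma card_le_independence_number:
  "finite (verts G) \<Longrightarrow> independent_set G S \<Longrightarrow> card S \<le> independence_number G"
  unfolding independence_number_def by (intro Max_ge) (auto simp: finite_independent_sets)

lemma independence_number_witness:
  assumes "finite (verts G)"
  obtains S where "independent_set G S" "card S = independence_number G"
proof -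
  have "independent_set G {}" by (simp add: independent_set_def)
  then have "independence_number G \<in> card ` {S. independent_set G S}"
    unfolding independence_number_def using assms
    by (intro Max_in) (auto simp: finite_independent_sets)
  then show ?thesis using that by auto
qed

lemma independent_set_del_vert:
  "independent_set (pre_digraph.del_vert G u) S \<longleftrightarrow> independent_set G S \<and> u \<notin> S"
  unfolding independent_set_def arcs_ends_del_vert by (auto simp: pre_digraph.del_vert_simps)

lemma independent_set_del_edge:
  "independent_set (del_edge G e) S \<longleftrightarrow>
    S \<subseteq> verts G \<and> (\<forall>x\<in>S. \<forall>y\<in>S. x \<rightarrow>\<^bsub>G\<^esub> y \<longrightarrow> {x, y} = {tail G e, head G e})"
  unfolding independent_set_def arcs_ends_del_edge by auto

text \<open>
  A set witnessing \<open>\<alpha>(G - ab) > \<alpha>(G)\<close> must contain both \<open>a\<close> and \<open>b\<close>, so it avoids all other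
  neighbours of these two; dropping \<open>a\<close> leaves a maximum independent set of \<open>G\<close>.
\<close>

lemma (in graph) alpha_critical_maximum_independent_set:
  assumes crit: "alpha_critical G" and ab: "a \<rightarrow> b"
  obtains S where "independent_set G S" "card S = independence_number G" "a \<notin> S"
    "\<And>c. c \<rightarrow> a \<or> c \<rightarrow> b \<Longrightarrow> c \<noteq> b \<Longrightarrow> c \<notin> S"
proof -
  obtain e where e: "e \<in> arcs G" "tail G e = a" "head G e = b" using ab by auto
  obtain I where "independent_set (del_edge G e) I"
    and cardI: "card I = independence_number (del_edge G e)"
    using independence_number_witness[of "del_edge G e"] by auto
  then have sub: "I \<subseteq> verts G"
    and adj: "\<And>x y. x \<in> I \<Longrightarrow> y \<in> I \<Longrightarrow> x \<rightarrow> y \<Longrightarrow> {x, y} = {a, b}"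
    using e by (auto simp: independent_set_del_edge)
  have gt: "independence_number G < card I"
    using crit e cardI by (auto simp: alpha_critical_def)
  have finI: "finite I" using sub by (rule finite_subset) simp
  have "\<not> independent_set G I"
    using gt card_le_independence_number[of G I] by auto
  then obtain x y where xy: "x \<in> I" "y \<in> I" "x \<rightarrow> y"
    using sub by (auto simp: independent_set_def)
  from adj[OF xy] xy have "a \<in> I" "b \<in> I" by (auto simp: doubleton_eq_iff)
  have "a \<noteq> b" using ab adj_not_same by blast
  have ind: "independent_set G (I - {a})"
    unfolding independent_set_def
  proof (intro conjI ballI)
    show "I - {a} \<subseteq> verts G" using sub by auto
    show "\<not> x \<rightarrow> y" if "x \<in> I - {a}" "y \<in> I - {a}" for x y
      using that adj[of x y] by (auto simp: doubleton_eq_iff)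
  qed
  have card: "card (I - {a}) = independence_number G"
  proof (rule antisym)
    show "card (I - {a}) \<le> independence_number G"
      using ind by (intro card_le_independence_number) auto
    show "independence_number G \<le> card (I - {a})"
      using gt \<open>a \<in> I\<close> finI by simp
  qed
  have avoid: "c \<notin> I - {a}" if "c \<rightarrow> a \<or> c \<rightarrow> b" "c \<noteq> b" for c
  proof
    assume "c \<in> I - {a}"
    moreover from this have "{c, a} = {a, b} \<or> {c, b} = {a, b}"
      using that adj[of c a] adj[of c b] \<open>a \<in> I\<close> \<open>b \<in> I\<close> by auto
    ultimately show False using that by (auto simp: doubleton_eq_iff)
  qed
  show ?thesis
    by (rule that[OF ind card _ avoid]) auto
qed

section \<open>Unions of components\<close>

text \<open>
  For symmetric \<open>G\<close> these are exactly the unions of vertex sets of components.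
\<close>

definition separated :: "('a, 'b) pre_digraph \<Rightarrow> 'a set \<Rightarrow> bool" where
  "separated G W \<longleftrightarrow> W \<subseteq> verts G \<and> (\<forall>x y. x \<rightarrow>\<^bsub>G\<^esub> y \<longrightarrow> (x \<in> W \<longleftrightarrow> y \<in> W))"

lemma arcs_ends_induce: "x \<rightarrow>\<^bsub>G \<restriction> W\<^esub> y \<longleftrightarrow> x \<rightarrow>\<^bsub>G\<^esub> y \<and> x \<in> W \<and> y \<in> W"
  by (auto simp: arcs_ends_conv)

lemma independent_set_induce:
  "W \<subseteq> verts G \<Longrightarrow> independent_set (G \<restriction> W) S \<longleftrightarrow> independent_set G S \<and> S \<subseteq> W"
  unfolding independent_set_def arcs_ends_induce induce_subgraph_verts by blast

lemma independent_set_Un_separated: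
  assumes "separated G W" "independent_set G S" "independent_set G T"
  shows "independent_set G ((S \<inter> W) \<union> (T - W))"
  unfolding independent_set_def
proof (intro conjI ballI)
  show "(S \<inter> W) \<union> (T - W) \<subseteq> verts G"
    using assms by (auto simp: independent_set_def)
  fix x y assume "x \<in> (S \<inter> W) \<union> (T - W)" "y \<in> (S \<inter> W) \<union> (T - W)"
  moreover have "(x \<in> W \<longleftrightarrow> y \<in> W)" if "x \<rightarrow>\<^bsub>G\<^esub> y"
    using assms(1) that by (simp add: separated_def)
  ultimately show "\<not> x \<rightarrow>\<^bsub>G\<^esub> y"
    using assms(2,3) by (auto simp: independent_set_def)
qed

lemma independence_number_separated:
  assumes sep: "separated G W" and fin: "finite (verts G)"
  shows "independence_number G =
    independence_number (G \<restriction> W) + independence_number (G \<restriction> (verts G - W))"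
proof (rule antisym)
  have W: "W \<subseteq> verts G" using sep by (simp add: separated_def)
  have finW: "finite W" using W fin by (rule finite_subset)
  obtain S where S: "independent_set G S" "card S = independence_number G"
    using independence_number_witness[OF fin] .
  have "independent_set (G \<restriction> W) (S \<inter> W)"
    using S(1) W by (auto simp: independent_set_induce intro: independent_set_subset)
  moreover have "independent_set (G \<restriction> (verts G - W)) (S - W)"
    using S(1) by (subst independent_set_induce)
      (auto intro: independent_set_subset simp: independent_set_def)
  ultimately have "card (S \<inter> W) \<le> independence_number (G \<restriction> W)"
    "card (S - W) \<le> independence_number (G \<restriction> (verts G - W))"
    using fin finW by (auto intro!: card_le_independence_number)
  then show "independence_number G \<le>
      independence_number (G \<restriction> W) + independence_number (G \<restriction> (verts G - W))"
    using S card_Int_Diff[OF independent_set_finite[OF fin S(1)], of W] by simp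
  obtain A where A: "independent_set (G \<restriction> W) A" "card A = independence_number (G \<restriction> W)"
    using independence_number_witness[of "G \<restriction> W"] finW by auto
  obtain B where B: "independent_set (G \<restriction> (verts G - W)) B"
      "card B = independence_number (G \<restriction> (verts G - W))"
    using independence_number_witness[of "G \<restriction> (verts G - W)"] fin by auto
  have A': "independent_set G A" "A \<subseteq> W" using A W by (auto simp: independent_set_induce)
  have B': "independent_set G B" "B \<subseteq> verts G - W" using B by (auto simp: independent_set_induce)
  have "(A \<inter> W) \<union> (B - W) = A \<union> B" using A' B' by auto
  then have "independent_set G (A \<union> B)"
    using independent_set_Un_separated[OF sep A'(1) B'(1)] by simp
  then have "card (A \<union> B) \<le> independence_number G"
    using fin by (rule card_le_independence_number[rotated])
  moreover have "card (A \<union> B) = card A + card B"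
    using A' B' fin by (intro card_Un_disjoint) (auto intro: independent_set_finite)
  ultimately show "independence_number (G \<restriction> W) + independence_number (G \<restriction> (verts G - W))
      \<le> independence_number G"
    using A(2) B(2) by simp
qed

text \<open>
  For an edge \<open>e\<close> of a component \<open>C\<close>, the set of vertices of \<open>C\<close> is separated both in \<open>G\<close> and in
  \<open>G - e\<close>, and the two graphs agree outside it.  By additivity \<open>\<alpha>(G)\<close> and \<open>\<alpha>(C)\<close> grow by
  the same amount when \<open>e\<close> is deleted.
\<close>

lemma (in graph) alpha_critical_sccs:
  "alpha_critical G \<longleftrightarrow> (\<forall>C \<in> sccs. alpha_critical C)"
proof -
  have sep: "separated G (verts C)" and ind: "C = G \<restriction> verts C" if C: "C \<in> sccs" for C
  proof -
    have sub: "induced_subgraph C G" using C by (rule in_sccs_imp_induced)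
    have "verts C \<in> sccs_verts" unfolding sccs_verts_conv using C by (rule imageI)
    show "C = G \<restriction> verts C" using induce_eq_iff_induced[OF sub] by (rule sym)
    have "y \<in> verts C" if "x \<rightarrow> y" "x \<in> verts C" for x y
    proof -
      have "x \<rightarrow>\<^sup>* y" "y \<rightarrow>\<^sup>* x" using that(1) graph_symmetric by blast+
      then show ?thesis
        using \<open>verts C \<in> sccs_verts\<close> that(2) unfolding in_sccs_verts_conv_reachable by blast
    qed
    moreover have "verts C \<subseteq> verts G" using sub by (auto dest: induced_imp_subgraph)
    ultimately show "separated G (verts C)"
      using graph_symmetric unfolding separated_def by blast
  qed
  have shift: "independence_number (del_edge G e) > independence_number G \<longleftrightarrow>
      independence_number (del_edge C e) > independence_number C"
    if C: "C \<in> sccs" and e: "e \<in> arcs C" for C e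
  proof -
    define W where "W = verts C"
    have CW: "C = G \<restriction> W" unfolding W_def using C by (rule ind)
    have eW: "tail G e \<in> W" "head G e \<in> W" using e CW by auto
    have sepG: "separated G W" unfolding W_def using C by (rule sep)
    then have "separated (del_edge G e) W"
      by (auto simp: separated_def arcs_ends_del_edge)
    then have "independence_number (del_edge G e) =
        independence_number (del_edge G e \<restriction> W) + independence_number (del_edge G e \<restriction> (verts G - W))"
      using independence_number_separated[of "del_edge G e" W] by simp
    also have "del_edge G e \<restriction> W = del_edge C e"
      unfolding CW by (intro pre_digraph.equality) auto
    also have "del_edge G e \<restriction> (verts G - W) = G \<restriction> (verts G - W)"
      using eW by (intro pre_digraph.equality) (auto simp: doubleton_eq_iff)
    finally show ?thesis
      using independence_number_separated[OF sepG] CW by simp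
  qed
  show ?thesis
  proof (intro iffI ballI)
    fix C assume crit: "alpha_critical G" and C: "C \<in> sccs"
    have "subgraph C G" using C by (intro induced_imp_subgraph in_sccs_imp_induced)
    then have "arcs C \<subseteq> arcs G" by (simp add: subgraph_def)
    then show "alpha_critical C"
      using crit shift[OF C] unfolding alpha_critical_def by blast
  next
    assume crit: "\<forall>C \<in> sccs. alpha_critical C"
    show "alpha_critical G"
      unfolding alpha_critical_def
    proof
      fix e assume e: "e \<in> arcs G"
      define C where "C = G \<restriction> {v. tail G e \<rightarrow>\<^sup>* v}"
      have "tail G e \<rightarrow> head G e" using e by (auto simp: arcs_ends_conv)
      then have "e \<in> arcs C" using e by (simp add: C_def)
      moreover have C: "C \<in> sccs"
        unfolding C_def using e by (intro induce_reachable_is_in_sccs) simp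
      ultimately show "independence_number (del_edge G e) > independence_number G"
        using crit shift[OF C] unfolding alpha_critical_def by blast
    qed
  qed
qed

lemma (in graph) sccs_nonempty_arcs_iff:
  "(\<forall>C \<in> sccs. arcs C \<noteq> {}) \<longleftrightarrow> (\<forall>x \<in> verts G. \<exists>y. x \<rightarrow> y)"
proof (intro iffI ballI)
  fix x assume arcs: "\<forall>C \<in> sccs. arcs C \<noteq> {}" and x: "x \<in> verts G"
  have "(G \<restriction> {v. x \<rightarrow>\<^sup>* v}) \<in> sccs" using x by (rule induce_reachable_is_in_sccs)
  with arcs have "arcs (G \<restriction> {v. x \<rightarrow>\<^sup>* v}) \<noteq> {}" by (rule bspec)
  then obtain e where e: "e \<in> arcs G" "x \<rightarrow>\<^sup>* tail G e" "x \<rightarrow>\<^sup>* head G e" by auto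
  show "\<exists>y. x \<rightarrow> y"
    using e(2)
  proof (cases rule: converse_reachable_cases)
    case base
    then have "x \<rightarrow> head G e" using e(1) by (auto simp: arcs_ends_conv)
    then show ?thesis ..
  qed blast
next
  fix C assume nbr: "\<forall>x \<in> verts G. \<exists>y. x \<rightarrow> y" and C: "C \<in> sccs"
  obtain x where x: "x \<in> verts C" using C unfolding sccs_def strongly_connected_def by blast
  have sub: "induced_subgraph C G" using C by (rule in_sccs_imp_induced)
  then have "x \<in> verts G" using x by (auto dest: induced_imp_subgraph)
  then obtain y where y: "x \<rightarrow> y" using nbr by blast
  have "verts C \<in> sccs_verts" unfolding sccs_verts_conv using C by (rule imageI)
  moreover have "x \<rightarrow>\<^sup>* y" "y \<rightarrow>\<^sup>* x" using y graph_symmetric by blast+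
  ultimately have yC: "y \<in> verts C" using x unfolding in_sccs_verts_conv_reachable by blast
  obtain e where "e \<in> arcs G" "tail G e = x" "head G e = y" using y by (rule reachableE)
  then have "e \<in> arcs C" using x yC sub by (simp add: induced_subgraph_def)
  then show "arcs C \<noteq> {}" by blast
qed

section \<open>Graphs with a universal vertex\<close>

lemma (in graph) two_less_vdist_commute:
  assumes "x \<in> verts G" "y \<in> verts G"
  shows "enat 2 < vdist G x y \<longleftrightarrow> enat 2 < vdist G y x"
  using two_less_vdist_iff[OF assms] two_less_vdist_iff[OF assms(2,1)] adj_sym by blast

text \<open>
  The upper bound gives colour 1 to a maximum independent set of \<open>G - u\<close> and colour 2 to \<open>u\<close>.  The
  lower bound holds because any two vertices are at distance at most 2; the vertex \<open>v\<close> covers the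
  case that the first class is \<open>{u}\<close>.
\<close>

lemma (in graph) packing_chromatic_universal:
  assumes univ: "universal G u" and v: "v \<in> verts G" "v \<noteq> u"
  shows "packing_chromatic G + independence_number (del_vert u) = card (verts G) + 1"
proof (rule antisym)
  let ?F = "del_vert u"
  have u: "u \<in> verts G" and adj: "\<And>x. x \<in> verts G \<Longrightarrow> x \<noteq> u \<Longrightarrow> u \<rightarrow> x"
    using univ by (auto simp: universal_def)
  have finF: "finite (verts ?F)" by (simp add: pre_digraph.del_vert_simps)
  obtain I where I: "independent_set ?F I" "card I = independence_number ?F"
    using independence_number_witness[OF finF] .
  then have "packing G 1 I" "u \<notin> I"
    unfolding packing_one_iff by (auto simp: independent_set_del_vert)
  then have "packing_chromatic G + card I + card {u} \<le> card (verts G) + 2"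
    using u by (intro packing_chromatic_two_classes packing_singleton) auto
  then show "packing_chromatic G + independence_number ?F \<le> card (verts G) + 1"
    using I(2) by simp
  obtain X where k: "1 \<le> packing_chromatic G"
    and X: "packing_partition G (packing_chromatic G) X"
    using packing_chromatic_partition[of G] by auto
  have near: "vdist G y z \<le> enat 2" if "y \<in> verts G" "z \<in> verts G" "y \<noteq> z" for y z
  proof -
    have "y \<rightarrow> z \<or> (y \<rightarrow> u \<and> u \<rightarrow> z)" using that adj adj_sym by metis
    then have "\<not> enat 2 < vdist G y z" using two_less_vdist_iff[OF that(1,2)] by blast
    then show ?thesis by simp
  qed
  have "card (verts G - {}) + 1 \<le> card (X 1 - {}) + packing_chromatic G"
    using X k near by (intro card_le_packing_partition) auto
  moreover have "card (X 1) \<le> independence_number ?F"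
  proof -
    have "packing G 1 (X 1)" using X k by (auto simp: packing_partition_def)
    then have ind: "independent_set G (X 1)" by (simp only: packing_one_iff)
    show ?thesis
    proof (cases "u \<in> X 1")
      case True
      then have "X 1 \<subseteq> {u}" using ind adj by (auto simp: independent_set_def)
      then have "card (X 1) \<le> card {v}" using card_mono[of "{u}" "X 1"] by simp
      moreover have "independent_set ?F {v}"
        unfolding independent_set_del_vert using v adj_not_same[of v]
        by (auto simp: independent_set_def)
      then have "card {v} \<le> independence_number ?F" by (rule card_le_independence_number[OF finF])
      ultimately show ?thesis by (rule order_trans)
    next
      case False
      then have "independent_set ?F (X 1)" using ind by (simp add: independent_set_del_vert)
      then show ?thesis by (rule card_le_independence_number[OF finF])
    qed
  qed
  ultimately show "card (verts G) + 1 \<le> packing_chromatic G + independence_number ?F"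
    by simp
qed

lemma (in graph) packing_chromatic_del_edge_avoiding_universal:
  assumes univ: "universal G u" and e: "e \<in> arcs (del_vert u)"
  shows "packing_chromatic (del_edge G e) < packing_chromatic G \<longleftrightarrow>
    independence_number (del_vert u) < independence_number (del_edge (del_vert u) e)"
proof -
  interpret H: graph "del_edge G e" by (rule graph_del_edge)
  have v: "head G e \<in> verts G" "head G e \<noteq> u" using e by (auto simp: pre_digraph.del_vert_simps)
  have "universal (del_edge G e) u"
    using univ e by (auto simp: universal_def arcs_ends_del_edge doubleton_eq_iff pre_digraph.del_vert_simps)
  then have "packing_chromatic (del_edge G e) + independence_number (del_edge (del_vert u) e)
      = card (verts G) + 1"
    using H.packing_chromatic_universal[of u "head G e"] v by (simp add: del_vert_del_edge)
  moreover have "packing_chromatic G + independence_number (del_vert u) = card (verts G) + 1"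
    using univ v by (rule packing_chromatic_universal)
  ultimately show ?thesis by linarith
qed

text \<open>
  If some edge leaves the set \<open>W\<close> of vertices within distance 2 of \<open>x\<close>, then it ends in a vertex \<open>y\<close>
  at distance exactly 3, reached by a path \<open>x, a, b, y\<close>; a maximum independent set obtained from the
  critical edge \<open>ab\<close> avoids the neighbours \<open>x\<close> of \<open>a\<close> and \<open>y\<close> of \<open>b\<close>.

  Otherwise no edge leaves \<open>W\<close>.  A critical edge at \<open>x\<close> yields a maximum independent set \<open>S\<close> avoiding
  \<open>x\<close>, and one at \<open>y'\<close> a maximum independent set \<open>T\<close> avoiding \<open>y'\<close>.  Exchanging their parts in \<open>W\<close>
  gives two independent sets with the same total size, so both are again maximum, and the one that
  follows \<open>S\<close> in \<open>W\<close> and \<open>T\<close> outside avoids both vertices.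
\<close>

lemma (in graph) maximum_independent_set_avoiding_far_pair:
  assumes crit: "alpha_critical G" and noniso: "\<And>v. v \<in> verts G \<Longrightarrow> \<exists>w. v \<rightarrow> w"
    and x: "x \<in> verts G" and far: "y' \<in> verts G" "enat 2 < vdist G x y'"
  obtains y S where "y \<in> verts G" "enat 2 < vdist G x y"
    "independent_set G S" "card S = independence_number G" "x \<notin> S" "y \<notin> S"
proof -
  define W where "W = {z \<in> verts G. \<not> enat 2 < vdist G x z}"
  have W: "z \<in> W \<longleftrightarrow> z = x \<or> x \<rightarrow> z \<or> (\<exists>a. x \<rightarrow> a \<and> a \<rightarrow> z)" for z
    unfolding W_def using two_less_vdist_iff[OF x, of z] x adj_in_verts(2) by blast
  show ?thesis
  proof (cases "\<exists>b y. b \<in> W \<and> y \<notin> W \<and> b \<rightarrow> y")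
    case True
    then obtain b y where bw: "b \<in> W" "y \<notin> W" "b \<rightarrow> y" by blast
    then obtain a where a: "x \<rightarrow> a" "a \<rightarrow> b" "b \<noteq> x"
      using W[of b] W[of y] by metis
    obtain S where S: "independent_set G S" "card S = independence_number G"
      and avoid: "\<And>c. c \<rightarrow> a \<or> c \<rightarrow> b \<Longrightarrow> c \<noteq> b \<Longrightarrow> c \<notin> S"
      using alpha_critical_maximum_independent_set[OF crit a(2)] by metis
    have "x \<notin> S" using a by (intro avoid) auto
    moreover have "y \<notin> S"
    proof (rule avoid)
      show "y \<rightarrow> a \<or> y \<rightarrow> b" using graph_symmetric[OF bw(3)] ..
      show "y \<noteq> b" using bw by blast
    qed
    moreover have "y \<in> verts G" using bw(3) by (rule adj_in_verts)
    moreover from this have "enat 2 < vdist G x y" using bw(2) by (simp add: W_def)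
    ultimately show ?thesis using S by (intro that)
  next
    case False
    then have "x \<in> W \<longleftrightarrow> y \<in> W" if "x \<rightarrow> y" for x y
      using that graph_symmetric[OF that] by blast
    then have sep: "separated G W"
      by (auto simp: separated_def W_def)
    have y': "y' \<notin> W" "x \<in> W" using far W[of x] by (auto simp: W_def)
    obtain wx where "x \<rightarrow> wx" using noniso[OF x] ..
    obtain wy where "y' \<rightarrow> wy" using noniso[OF far(1)] ..
    obtain S where S: "independent_set G S" "card S = independence_number G" "x \<notin> S"
      using alpha_critical_maximum_independent_set[OF crit \<open>x \<rightarrow> wx\<close>] by metis
    obtain T where T: "independent_set G T" "card T = independence_number G" "y' \<notin> T"
      using alpha_critical_maximum_independent_set[OF crit \<open>y' \<rightarrow> wy\<close>] by metis
    have fin: "finite S" "finite T"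
      using S(1) T(1) by (auto intro: independent_set_finite[OF finite_verts])
    let ?A = "(S \<inter> W) \<union> (T - W)" and ?B = "(T \<inter> W) \<union> (S - W)"
    have A: "independent_set G ?A" and "independent_set G ?B"
      using independent_set_Un_separated[OF sep] S(1) T(1) by blast+
    then have le: "card ?A \<le> independence_number G" "card ?B \<le> independence_number G"
      by (auto intro!: card_le_independence_number)
    have "card ?A = card (S \<inter> W) + card (T - W)" "card ?B = card (T \<inter> W) + card (S - W)"
      using fin by (auto intro!: card_Un_disjoint)
    then have "card ?A + card ?B = card S + card T"
      using card_Int_Diff[OF fin(1), of W] card_Int_Diff[OF fin(2), of W] by simp
    then have "card ?A = independence_number G" using le S(2) T(2) by simp
    moreover have "x \<notin> ?A" "y' \<notin> ?A" using S(3) T(3) y' by auto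
    ultimately show ?thesis using far A by (intro that)
  qed
qed

context graph
begin

context
  fixes u x :: 'a and e :: 'b
  assumes univ: "universal G u"
    and x: "x \<in> verts G" "x \<noteq> u"
    and ends: "{tail G e, head G e} = {u, x}"
begin

lemma arcs_ends_del_universal_edge:
  "y \<rightarrow>\<^bsub>del_edge G e\<^esub> z \<longleftrightarrow> y \<rightarrow> z \<and> {y, z} \<noteq> {u, x}"
  by (simp add: arcs_ends_del_edge ends)

text \<open>
  No short connection from \<open>x\<close> to a vertex \<open>y\<close> far from it in \<open>G - u\<close> can use \<open>u\<close>, since \<open>ux\<close> is deleted.
  So \<open>{x, y}\<close> is a class of colour 2, disjoint from a maximum independent set suited for colour 1.
\<close>

lemma packing_chromatic_del_universal_edge_less:
  assumes crit: "alpha_critical (del_vert u)"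
    and noniso: "\<And>v. v \<in> verts G \<Longrightarrow> v \<noteq> u \<Longrightarrow> \<exists>w. v \<rightarrow>\<^bsub>del_vert u\<^esub> w"
    and far: "y' \<in> verts G" "y' \<noteq> u" "enat 2 < vdist (del_vert u) x y'"
  shows "packing_chromatic (del_edge G e) < packing_chromatic G"
proof -
  interpret F: graph "del_vert u" by (rule graph_del_vert)
  interpret H: graph "del_edge G e" by (rule graph_del_edge)
  have vF: "verts (del_vert u) = verts G - {u}" by (simp add: pre_digraph.del_vert_simps)
  have xF: "x \<in> verts (del_vert u)" using x vF by simp
  obtain y S where y: "y \<in> verts (del_vert u)" "enat 2 < vdist (del_vert u) x y"
    and S: "independent_set (del_vert u) S" "card S = independence_number (del_vert u)"
      "x \<notin> S" "y \<notin> S"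
    using F.maximum_independent_set_avoiding_far_pair[OF crit _ xF _ far(3)] noniso far(1,2)
    unfolding vF by blast
  have y': "y \<in> verts G" "y \<noteq> u" using y(1) vF by auto
  have F_far: "x \<noteq> y" "\<not> x \<rightarrow>\<^bsub>del_vert u\<^esub> y"
      "\<And>z. \<not> (x \<rightarrow>\<^bsub>del_vert u\<^esub> z \<and> z \<rightarrow>\<^bsub>del_vert u\<^esub> y)"
    using F.two_less_vdist_iff[OF xF y(1)] y(2) by blast+
  have "\<not> x \<rightarrow>\<^bsub>del_edge G e\<^esub> y"
    using F_far(2) x y' by (simp add: arcs_ends_del_edge arcs_ends_del_vert)
  moreover have "\<not> (x \<rightarrow>\<^bsub>del_edge G e\<^esub> z \<and> z \<rightarrow>\<^bsub>del_edge G e\<^esub> y)" for z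
    using F_far(3)[of z] x y'
    by (auto simp: arcs_ends_del_universal_edge arcs_ends_del_vert doubleton_eq_iff)
  ultimately have "enat 2 < vdist (del_edge G e) x y"
    using F_far(1) H.two_less_vdist_iff[of x y] x y' by simp
  moreover from this have "enat 2 < vdist (del_edge G e) y x"
    using H.two_less_vdist_commute[of x y] x y' by simp
  ultimately have "packing (del_edge G e) 2 {x, y}"
    using x y' by (auto simp: packing_def)
  moreover have "packing (del_edge G e) 1 S"
    using S(1) unfolding H.packing_one_iff independent_set_del_vert independent_set_del_edge
    by (simp add: independent_set_def)
  ultimately have "packing_chromatic (del_edge G e) + card S + card {x, y} \<le> card (verts G) + 2"
    using packing_chromatic_two_classes[of "del_edge G e" S "{x, y}"] S(3,4) by simp
  moreover have "packing_chromatic G + independence_number (del_vert u) = card (verts G) + 1"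
    using univ x by (rule packing_chromatic_universal)
  ultimately show ?thesis using S(2) F_far(1) by simp
qed

text \<open>
  All vertices other than \<open>x\<close> still have \<open>u\<close> as a common neighbour.
\<close>

lemma vdist_del_universal_edge_le_two:
  assumes yz: "y \<in> verts G - {x}" "z \<in> verts G - {x}" "y \<noteq> z"
  shows "vdist (del_edge G e) y z \<le> enat 2"
proof -
  interpret H: graph "del_edge G e" by (rule graph_del_edge)
  have adj: "u \<rightarrow>\<^bsub>del_edge G e\<^esub> v" if "v \<in> verts G - {x}" "v \<noteq> u" for v
    using that univ by (auto simp: arcs_ends_del_universal_edge universal_def doubleton_eq_iff)
  have "y \<rightarrow>\<^bsub>del_edge G e\<^esub> z \<or> (y \<rightarrow>\<^bsub>del_edge G e\<^esub> u \<and> u \<rightarrow>\<^bsub>del_edge G e\<^esub> z)"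
    using adj[of y] adj[of z] yz H.adj_sym by metis
  then have "\<not> enat 2 < vdist (del_edge G e) y z"
    using H.two_less_vdist_iff[of y z] yz by auto
  then show ?thesis by simp
qed

text \<open>
  After the deletion \<open>x\<close> is isolated.  The other vertices are pairwise within distance 2, and
  colour 1 is used on at most \<open>\<alpha>(G - u) - 1\<close> of them: either on \<open>u\<close> alone, or on an independent
  set of \<open>G - u - x\<close>, which \<open>x\<close> extends.
\<close>

lemma packing_chromatic_del_universal_edge_isolated:
  assumes two: "2 \<le> independence_number (del_vert u)"
    and iso: "\<not> (\<exists>w. x \<rightarrow>\<^bsub>del_vert u\<^esub> w)"
  shows "packing_chromatic G \<le> packing_chromatic (del_edge G e)"
proof -
  let ?H = "del_edge G e"
  interpret F: graph "del_vert u" by (rule graph_del_vert)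
  interpret H: graph ?H by (rule graph_del_edge)
  obtain X where k: "1 \<le> packing_chromatic ?H"
    and X: "packing_partition ?H (packing_chromatic ?H) X"
    using packing_chromatic_partition[of ?H] by auto
  have "card (verts ?H - {x}) + 1 \<le> card (X 1 - {x}) + packing_chromatic ?H"
    using X k vdist_del_universal_edge_le_two by (intro card_le_packing_partition) auto
  moreover have "card (X 1 - {x}) + 1 \<le> independence_number (del_vert u)"
  proof -
    have "packing ?H 1 (X 1)" using X k by (auto simp: packing_partition_def)
    then have ind: "independent_set ?H (X 1)" by (simp only: H.packing_one_iff)
    have finX: "finite (X 1)" using ind by (rule independent_set_finite[rotated]) simp
    show ?thesis
    proof (cases "u \<in> X 1")
      case True
      then have "X 1 - {x} \<subseteq> {u}"
        using ind univ by (auto simp: independent_set_def arcs_ends_del_universal_edge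
            universal_def doubleton_eq_iff)
      then have "card (X 1 - {x}) \<le> 1" using card_mono[of "{u}" "X 1 - {x}"] by simp
      then show ?thesis using two by simp
    next
      case False
      have "independent_set (del_vert u) (insert x (X 1 - {x}))"
        unfolding independent_set_def
      proof (intro conjI ballI)
        show "insert x (X 1 - {x}) \<subseteq> verts (del_vert u)"
          using ind x False by (auto simp: independent_set_def pre_digraph.del_vert_simps)
        fix y z assume yz: "y \<in> insert x (X 1 - {x})" "z \<in> insert x (X 1 - {x})"
        show "\<not> y \<rightarrow>\<^bsub>del_vert u\<^esub> z"
        proof (cases "y = x \<or> z = x")
          case True
          then show ?thesis using iso F.adj_sym by blast
        next
          case False
          then have "\<not> y \<rightarrow>\<^bsub>?H\<^esub> z" using yz ind by (auto simp: independent_set_def)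
          then show ?thesis
            using False by (auto simp: arcs_ends_del_universal_edge arcs_ends_del_vert doubleton_eq_iff)
        qed
      qed
      then have "card (insert x (X 1 - {x})) \<le> independence_number (del_vert u)"
        by (rule card_le_independence_number[rotated]) simp
      moreover have "card (insert x (X 1 - {x})) = Suc (card (X 1 - {x}))"
        using finX by (intro card_insert_disjoint) auto
      ultimately show ?thesis by simp
    qed
  qed
  moreover have "card (verts ?H - {x}) + 1 = card (verts G)"
    using x card_Suc_Diff1[of "verts G" x] by simp
  moreover have "packing_chromatic G + independence_number (del_vert u) = card (verts G) + 1"
    using univ x by (rule packing_chromatic_universal)
  ultimately show ?thesis by linarith
qed

text \<open>
  After the deletion, \<open>x\<close> still reaches \<open>u\<close> through \<open>w\<close> and the other vertices inside \<open>G - u\<close>, so the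
  diameter stays at most 2.  The only new independent set is \<open>{u, x}\<close>, which is no larger than
  \<open>\<alpha>(G - u)\<close>.
\<close>

lemma packing_chromatic_del_universal_edge_central:
  assumes two: "2 \<le> independence_number (del_vert u)"
    and nbr: "x \<rightarrow>\<^bsub>del_vert u\<^esub> w"
    and central: "\<And>y. y \<in> verts G \<Longrightarrow> y \<noteq> u \<Longrightarrow> \<not> enat 2 < vdist (del_vert u) x y"
  shows "packing_chromatic G \<le> packing_chromatic (del_edge G e)"
proof -
  let ?H = "del_edge G e"
  interpret F: graph "del_vert u" by (rule graph_del_vert)
  interpret H: graph ?H by (rule graph_del_edge)
  have finF: "finite (verts (del_vert u))" by simp
  have vF: "verts (del_vert u) = verts G - {u}" by (simp add: pre_digraph.del_vert_simps)
  have FH: "y \<rightarrow>\<^bsub>?H\<^esub> z" if "y \<rightarrow>\<^bsub>del_vert u\<^esub> z" for y z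
    using that by (auto simp: arcs_ends_del_universal_edge arcs_ends_del_vert doubleton_eq_iff)
  have from_x: "\<not> enat 2 < vdist ?H x z" if z: "z \<in> verts G" "z \<noteq> x" for z
  proof (cases "z = u")
    case True
    have "w \<in> verts G" "w \<noteq> u" using nbr F.adj_in_verts(2) vF by blast+
    moreover have "w \<noteq> x" using nbr F.adj_not_same by blast
    ultimately have "u \<rightarrow>\<^bsub>?H\<^esub> w"
      using univ by (auto simp: arcs_ends_del_universal_edge universal_def doubleton_eq_iff)
    then have "x \<rightarrow>\<^bsub>?H\<^esub> w \<and> w \<rightarrow>\<^bsub>?H\<^esub> z" using FH[OF nbr] H.adj_sym True by blast
    then show ?thesis using H.two_less_vdist_iff[of x z] x z by auto
  next
    case False
    then have "x = z \<or> x \<rightarrow>\<^bsub>del_vert u\<^esub> z \<or> (\<exists>a. x \<rightarrow>\<^bsub>del_vert u\<^esub> a \<and> a \<rightarrow>\<^bsub>del_vert u\<^esub> z)"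
      using central[of z] F.two_less_vdist_iff[of x z] x z vF by auto
    then have "x = z \<or> x \<rightarrow>\<^bsub>?H\<^esub> z \<or> (\<exists>a. x \<rightarrow>\<^bsub>?H\<^esub> a \<and> a \<rightarrow>\<^bsub>?H\<^esub> z)"
      using FH by blast
    then show ?thesis using H.two_less_vdist_iff[of x z] x z by simp
  qed
  have near: "vdist ?H y z \<le> enat 2" if yz: "y \<in> verts G" "z \<in> verts G" "y \<noteq> z" for y z
  proof (cases "y = x \<or> z = x")
    case True
    then have "\<not> enat 2 < vdist ?H y z"
      using from_x[of y] from_x[of z] H.two_less_vdist_commute[of y z] yz by auto
    then show ?thesis by simp
  next
    case False
    then show ?thesis using yz by (intro vdist_del_universal_edge_le_two) auto
  qed
  obtain X where k: "1 \<le> packing_chromatic ?H"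
    and X: "packing_partition ?H (packing_chromatic ?H) X"
    using packing_chromatic_partition[of ?H] by auto
  have "card (verts ?H - {}) + 1 \<le> card (X 1 - {}) + packing_chromatic ?H"
    using X k near by (intro card_le_packing_partition) auto
  moreover have "card (X 1) \<le> independence_number (del_vert u)"
  proof -
    have "packing ?H 1 (X 1)" using X k by (auto simp: packing_partition_def)
    then have ind: "independent_set ?H (X 1)" by (simp only: H.packing_one_iff)
    show ?thesis
    proof (cases "u \<in> X 1")
      case True
      then have "X 1 \<subseteq> {u, x}"
        using ind univ by (auto simp: independent_set_def arcs_ends_del_universal_edge
            universal_def doubleton_eq_iff)
      then have "card (X 1) \<le> card {u, x}" by (rule card_mono[rotated]) simp
      then show ?thesis using two x by simp
    next
      case False
      then have "independent_set (del_vert u) (X 1)"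
        using ind by (auto simp: independent_set_def arcs_ends_del_universal_edge
            arcs_ends_del_vert vF doubleton_eq_iff)
      then show ?thesis by (rule card_le_independence_number[OF finF])
    qed
  qed
  moreover have "packing_chromatic G + independence_number (del_vert u) = card (verts G) + 1"
    using univ x by (rule packing_chromatic_universal)
  ultimately show ?thesis by simp
qed

end

end

text \<open>
  Two nonadjacent vertices make \<open>\<alpha>(G - u) \<ge> 2\<close>, which the two lower bounds for deleted edges at \<open>u\<close>
  require.
\<close>

lemma (in graph) packing_critical_universal_iff:
  assumes univ: "universal G u"
    and nonadj: "y \<in> verts G" "z \<in> verts G" "y \<noteq> z" "\<not> y \<rightarrow> z"
  shows "packing_critical G \<longleftrightarrow> alpha_critical (del_vert u) \<and>
    (\<forall>x \<in> verts (del_vert u). (\<exists>w. x \<rightarrow>\<^bsub>del_vert u\<^esub> w) \<and>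
      (\<exists>w \<in> verts (del_vert u). enat 2 < vdist (del_vert u) x w))"
proof -
  let ?F = "del_vert u"
  interpret F: graph ?F by (rule graph_del_vert)
  have vF: "verts ?F = verts G - {u}" by (simp add: pre_digraph.del_vert_simps)
  have adj: "u \<rightarrow> x" if "x \<in> verts G" "x \<noteq> u" for x
    using univ that by (simp add: universal_def)
  have yz: "y \<noteq> u" "z \<noteq> u" using nonadj adj adj_sym by metis+
  have two: "2 \<le> independence_number ?F"
  proof -
    have "independent_set ?F {y, z}"
      unfolding independent_set_del_vert
      using nonadj yz graph_symmetric[of z y] adj_not_same[of y] adj_not_same[of z]
      by (auto simp: independent_set_def)
    then have "card {y, z} \<le> independence_number ?F"
      by (rule card_le_independence_number[rotated]) simp
    then show ?thesis using nonadj(3) by simp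
  qed
  have noniso: "\<exists>w. x \<rightarrow> w" if "x \<in> verts G" for x
    using adj[of x] adj[of y] adj_sym that nonadj(1) yz(1) by (cases "x = u") blast+
  have crit_iff: "packing_critical G \<longleftrightarrow>
      (\<forall>e \<in> arcs G. packing_chromatic (del_edge G e) < packing_chromatic G)"
    using noniso by (rule packing_critical_iff_edges)
  show ?thesis
  proof (intro iffI conjI ballI)
    assume crit: "packing_critical G"
    show "alpha_critical ?F"
      unfolding alpha_critical_def
    proof
      fix e assume e: "e \<in> arcs ?F"
      then have "e \<in> arcs G" by (simp add: pre_digraph.del_vert_simps)
      then show "independence_number ?F < independence_number (del_edge ?F e)"
        using crit crit_iff packing_chromatic_del_edge_avoiding_universal[OF univ e] by blast
    qed
    fix x assume "x \<in> verts ?F"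
    then have x: "x \<in> verts G" "x \<noteq> u" by (auto simp: vF)
    obtain e where e: "e \<in> arcs G" "tail G e = u" "head G e = x" using adj[OF x] by (rule reachableE)
    then have ends: "{tail G e, head G e} = {u, x}" by simp
    have less: "packing_chromatic (del_edge G e) < packing_chromatic G"
      using crit crit_iff e(1) by blast
    show "\<exists>w. x \<rightarrow>\<^bsub>?F\<^esub> w"
      using packing_chromatic_del_universal_edge_isolated[OF univ x ends two] less
      by (auto simp: not_le[symmetric])
    then obtain v where nbr: "x \<rightarrow>\<^bsub>?F\<^esub> v" ..
    show "\<exists>w \<in> verts ?F. enat 2 < vdist ?F x w"
    proof (rule ccontr)
      assume "\<not> ?thesis"
      then have "\<not> enat 2 < vdist ?F x w" if "w \<in> verts G" "w \<noteq> u" for w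
        using that by (auto simp: vF)
      then have "packing_chromatic G \<le> packing_chromatic (del_edge G e)"
        by (rule packing_chromatic_del_universal_edge_central[OF univ x ends two nbr])
      with less show False by simp
    qed
  next
    assume *: "alpha_critical ?F \<and> (\<forall>x \<in> verts ?F. (\<exists>w. x \<rightarrow>\<^bsub>?F\<^esub> w) \<and>
      (\<exists>w \<in> verts ?F. enat 2 < vdist ?F x w))"
    have "packing_chromatic (del_edge G e) < packing_chromatic G" if e: "e \<in> arcs G" for e
    proof (cases "e \<in> arcs ?F")
      case True
      then show ?thesis
        using * packing_chromatic_del_edge_avoiding_universal[OF univ True]
        by (auto simp: alpha_critical_def)
    next
      case False
      define x where "x = (if tail G e = u then head G e else tail G e)"
      have "tail G e = u \<or> head G e = u" using False e by (simp add: pre_digraph.del_vert_simps)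
      then have ends: "{tail G e, head G e} = {u, x}" by (auto simp: x_def)
      have x: "x \<in> verts G" "x \<noteq> u"
        using e no_loops[OF e] by (auto simp: x_def)
      then have "x \<in> verts ?F" by (simp add: vF)
      then obtain w where w: "w \<in> verts ?F" "enat 2 < vdist ?F x w" using * by blast
      show ?thesis
      proof (rule packing_chromatic_del_universal_edge_less[OF univ x ends])
        show "alpha_critical ?F" using * ..
        show "w \<in> verts G" "w \<noteq> u" using w(1) by (simp_all add: vF)
        show "\<exists>w. v \<rightarrow>\<^bsub>?F\<^esub> w" if "v \<in> verts G" "v \<noteq> u" for v
          using * that by (simp add: vF)
      qed (rule w(2))
    qed
    then show "packing_critical G" unfolding crit_iff by (rule ballI)
  qed
qed

section \<open>The characterization\<close>

lemma (in graph) radius_ge_three_iff: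
  "3 \<le> radius G \<longleftrightarrow> (\<forall>x \<in> verts G. \<exists>y \<in> verts G. enat 2 < vdist G x y)"
proof -
  have "3 \<le> ecc G x \<longleftrightarrow> (\<exists>y \<in> verts G. enat 2 < vdist G x y)" if x: "x \<in> verts G" for x
  proof
    assume three: "3 \<le> ecc G x"
    show "\<exists>y \<in> verts G. enat 2 < vdist G x y"
    proof (rule ccontr)
      assume "\<not> ?thesis"
      then have "ecc G x \<le> enat 2"
        unfolding ecc_def by (intro SUP_least) (auto simp: not_less)
      with three have "(3 :: enat) \<le> enat 2" by (rule order_trans)
      then show False by (simp add: numeral_eq_enat)
    qed
  next
    assume "\<exists>y \<in> verts G. enat 2 < vdist G x y"
    then obtain y where y: "y \<in> verts G" "enat 2 < vdist G x y" by blast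
    then have "y \<in> verts G - {x}" using two_less_vdist_iff[OF x, of y] by blast
    then have "vdist G x y \<le> ecc G x" unfolding ecc_def by (rule SUP_upper)
    moreover have "3 \<le> vdist G x y"
      using y(2) Suc_ile_eq[of 2 "vdist G x y"] by (simp add: numeral_eq_enat)
    ultimately show "3 \<le> ecc G x" by (rule order_trans[rotated])
  qed
  then show ?thesis by (auto simp: radius_def le_INF_iff)
qed

lemma (in graph) connected_iff_reachable:
  "connected G \<longleftrightarrow> verts G \<noteq> {} \<and> (\<forall>x \<in> verts G. \<forall>y \<in> verts G. x \<rightarrow>\<^sup>* y)"
  unfolding connected_def strongly_connected_def
  by (simp add: reachable_mk_symmetric_eq[OF sym_arcs])

lemma (in graph) two_less_vdist_unreachable:
  "\<not> x \<rightarrow>\<^sup>* y \<Longrightarrow> enat 2 < vdist G x y"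
  by (auto simp: enat_less_vdist_iff reachable_apath)

theorem theorem3p10:
  fixes G :: "('a, 'b) pre_digraph" and u :: 'a
  assumes "graph G"
    and "radius G = 1"
    and "diam G = 2"
    and "universal G u"
  shows "packing_critical G \<longleftrightarrow>
    (connected (pre_digraph.del_vert G u) \<and>
       radius (pre_digraph.del_vert G u) \<ge> 3 \<and>
       alpha_critical (pre_digraph.del_vert G u))
    \<or> (\<not> connected (pre_digraph.del_vert G u) \<and>
       (\<forall>C \<in> components (pre_digraph.del_vert G u). alpha_critical C \<and> arcs C \<noteq> {}))"
proof -
  let ?F = "pre_digraph.del_vert G u"
  interpret graph G by fact
  interpret F: graph ?F by (rule graph_del_vert)
  have vF: "verts ?F = verts G - {u}" by (simp add: pre_digraph.del_vert_simps)
  have "\<exists>y z. y \<in> verts G \<and> z \<in> verts G \<and> y \<noteq> z \<and> \<not> y \<rightarrow>\<^bsub>G\<^esub> z"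
  proof (rule ccontr)
    assume complete: "\<not> ?thesis"
    have "vdist G y z \<le> enat 1" if "y \<in> verts G" "z \<in> verts G - {y}" for y z
      using complete that one_less_vdist_iff[of y z] by (auto simp: not_less[symmetric])
    then have "diam G \<le> enat 1"
      unfolding diam_def ecc_def by (intro SUP_least)
    then show False using assms(3) by (simp add: numeral_eq_enat)
  qed
  then obtain y z where yz: "y \<in> verts G" "z \<in> verts G" "y \<noteq> z" "\<not> y \<rightarrow>\<^bsub>G\<^esub> z" by blast
  have yzF: "y \<in> verts ?F" "z \<in> verts ?F"
    using yz \<open>universal G u\<close> graph_symmetric[of u y] by (auto simp: vF universal_def)
  let ?noniso = "\<forall>x \<in> verts ?F. \<exists>w. x \<rightarrow>\<^bsub>?F\<^esub> w"
  let ?far = "\<forall>x \<in> verts ?F. \<exists>w \<in> verts ?F. enat 2 < vdist ?F x w"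
  have crit: "packing_critical G \<longleftrightarrow> alpha_critical ?F \<and> ?noniso \<and> ?far"
    using packing_critical_universal_iff[OF \<open>universal G u\<close> yz] by blast
  show ?thesis
  proof (cases "connected ?F")
    case True
    have ?noniso
    proof
      fix x assume x: "x \<in> verts ?F"
      obtain v where v: "v \<in> verts ?F" "v \<noteq> x" using yzF yz(3) by metis
      have "x \<rightarrow>\<^sup>*\<^bsub>?F\<^esub> v" using True x v(1) by (simp add: F.connected_iff_reachable)
      then show "\<exists>w. x \<rightarrow>\<^bsub>?F\<^esub> w"
        using v(2) by (cases rule: F.converse_reachable_cases) auto
    qed
    then show ?thesis
      using True crit F.radius_ge_three_iff by blast
  next
    case False
    have ?far
    proof
      fix x assume x: "x \<in> verts ?F"
      have "\<exists>w \<in> verts ?F. \<not> x \<rightarrow>\<^sup>*\<^bsub>?F\<^esub> w"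
      proof (rule ccontr)
        assume all: "\<not> ?thesis"
        have "v \<rightarrow>\<^sup>*\<^bsub>?F\<^esub> w" if "v \<in> verts ?F" "w \<in> verts ?F" for v w
          using all that F.symmetric_reachable'[of x v] F.reachable_trans[of v x w] by blast
        then show False using False x by (auto simp: F.connected_iff_reachable)
      qed
      then show "\<exists>w \<in> verts ?F. enat 2 < vdist ?F x w"
        using F.two_less_vdist_unreachable by blast
    qed
    then have "packing_critical G \<longleftrightarrow>
        (\<forall>C \<in> components ?F. alpha_critical C) \<and> (\<forall>C \<in> components ?F. arcs C \<noteq> {})"
      unfolding F.sccs_nonempty_arcs_iff using crit F.alpha_critical_sccs by blast
    then show ?thesis using False by blast
  qed
qed

end
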